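(* Let $f\in\mathbb{R}\setminus\mathbb{Z}$ and let $\pi\colon\mathbb{R}\to\mathbb{R}$ be a valid function (for $f$) that is continuous piecewise linear (its breakpoints are not required to be rational). Then $\pi$ is an extreme function if and only if $\pi$ is a facet.
   Context: Fix $f\in\mathbb{R}\setminus\mathbb{Z}$. Let $F_f$ be the set of finite-support functions $y\colon\mathbb{R}\to\mathbb{Z}_+$ (nonnegative integers) with $\sum_{r\in\mathbb{R}} r\,y(r)\in f+\mathbb{Z}$. A function $\pi\colon\mathbb{R}\to\mathbb{R}$ is a valid function if $\pi\ge 0$ and $\sum_{r\in\mathbb{R}}\pi(r)y(r)\ge 1$ for all $y\in F_f$. For a valid function $\pi$ let $P(\pi)=\{y\in F_f : \sum_{r}\pi(r)y(r)=1\}$. A valid function $\pi$ is an extreme function if whenever $\pi=\tfrac12(\pi^1+\pi^2)$ with $\pi^1,\pi^2$ valid functions, one has $\pi=\pi^1=\pi^2$. A valid function $\pi$ is a facet if for every valid function $\pi'$ with $P(\pi)\subseteq P(\pi')$ one has $\pi'=\pi$. A function $\pi\colon\mathbb{R}\to\mathbb{R}$ is continuous piecewise linear if there is a locally finite one-dimensional polyhedral complex $\mathcal{P}$ covering $\mathbb{R}$ (closed intervals with disjoint interiors together with their endpoints, only finitely many meeting any bounded set) such that $\pi$ is affine on each cell of $\mathcal{P}$. *)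

theory Defs
  imports "HOL-Analysis.Analysis"
begin

definition group_feasible :: "real \<Rightarrow> (real \<Rightarrow> nat) set" where
  "group_feasible f =
     {y. finite {r. y r \<noteq> 0} \<and> (\<exists>k::int. (\<Sum>r | y r \<noteq> 0. r * real (y r)) = f + of_int k)}"

text \<open>The library sum over an infinite set is 0, so the next sum is meaningful only for
  finitely supported \<open>y\<close>; below it is applied to elements of \<^const>\<open>group_feasible\<close> only.\<close>

definition weight :: "(real \<Rightarrow> real) \<Rightarrow> (real \<Rightarrow> nat) \<Rightarrow> real" where
  "weight \<pi> y = (\<Sum>r | y r \<noteq> 0. \<pi> r * real (y r))"

definition valid_function :: "real \<Rightarrow> (real \<Rightarrow> real) \<Rightarrow> bool" where
  "valid_function f \<pi> \<longleftrightarrow> (\<forall>r. 0 \<le> \<pi> r) \<and> (\<forall>y\<in>group_feasible f. 1 \<le> weight \<pi> y)"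

definition tight_set :: "real \<Rightarrow> (real \<Rightarrow> real) \<Rightarrow> (real \<Rightarrow> nat) set" where
  "tight_set f \<pi> = {y \<in> group_feasible f. weight \<pi> y = 1}"

definition extreme_function :: "real \<Rightarrow> (real \<Rightarrow> real) \<Rightarrow> bool" where
  "extreme_function f \<pi> \<longleftrightarrow>
     valid_function f \<pi> \<and>
     (\<forall>\<pi>\<^sub>1 \<pi>\<^sub>2. valid_function f \<pi>\<^sub>1 \<longrightarrow> valid_function f \<pi>\<^sub>2 \<longrightarrow>
        \<pi> = (\<lambda>r. (1/2) * (\<pi>\<^sub>1 r + \<pi>\<^sub>2 r)) \<longrightarrow> \<pi> = \<pi>\<^sub>1 \<and> \<pi> = \<pi>\<^sub>2)"

definition facet :: "real \<Rightarrow> (real \<Rightarrow> real) \<Rightarrow> bool" where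
  "facet f \<pi> \<longleftrightarrow>
     valid_function f \<pi> \<and>
     (\<forall>\<pi>'. valid_function f \<pi>' \<longrightarrow> tight_set f \<pi> \<subseteq> tight_set f \<pi>' \<longrightarrow> \<pi>' = \<pi>)"

text \<open>The polyhedra in the real line are the closed intervals (possibly unbounded), the
  singletons and the empty set; the proper nonempty faces of an interval are its endpoints.
  Hence a locally finite polyhedral complex covering the line consists of nondegenerate closed
  intervals with pairwise disjoint interiors and their endpoints (and possibly the empty set,
  which \<^const>\<open>face_of\<close> counts as a face); it is automatically one-dimensional.\<close>

definition polyhedral_complex :: "'a::euclidean_space set set \<Rightarrow> bool" where
  "polyhedral_complex \<P> \<longleftrightarrow>
     (\<forall>I\<in>\<P>. polyhedron I) \<and>
     (\<forall>I F. I \<in> \<P> \<and> F face_of I \<longrightarrow> F \<in> \<P>) \<and>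
     (\<forall>I J. I \<in> \<P> \<and> J \<in> \<P> \<longrightarrow> (I \<inter> J) face_of I \<and> (I \<inter> J) face_of J)"

definition locally_finite_cells :: "'a::metric_space set set \<Rightarrow> bool" where
  "locally_finite_cells \<P> \<longleftrightarrow> (\<forall>B. bounded B \<longrightarrow> finite {I\<in>\<P>. I \<inter> B \<noteq> {}})"

text \<open>Continuity needs no separate clause: the cells are closed, cover the line and are locally
  finite, and the affine pieces agree on common endpoints.\<close>

definition continuous_piecewise_linear :: "(real \<Rightarrow> real) \<Rightarrow> bool" where
  "continuous_piecewise_linear \<pi> \<longleftrightarrow>
     (\<exists>\<P>. polyhedral_complex \<P> \<and> locally_finite_cells \<P> \<and> \<Union>\<P> = UNIV \<and>
        (\<forall>I\<in>\<P>. \<exists>a b. \<forall>x\<in>I. \<pi> x = a * x + b))"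

end

theory Submission
  imports Defs
begin

text \<open>
  A facet is extreme because a solution that is tight for \<open>\<pi>\<close> is tight for both halves of a convex
  combination. Conversely, an extreme function \<open>\<pi>\<close> is minimal, hence subadditive, periodic and
  symmetric with respect to \<open>f\<close>. If \<open>\<pi>'\<close> is valid and tight wherever \<open>\<pi>\<close> is, then \<open>\<pi>'\<close> has the same
  properties and satisfies every additivity relation of \<open>\<pi>\<close>. Since \<open>\<pi>\<close> is linear on both sides of \<open>0\<close>,
  \<open>\<pi>'\<close> is additive near \<open>0\<close> on each side, and with subadditivity this makes \<open>\<pi>'\<close> Lipschitz. Around
  a zero of the subadditivity slack of \<open>\<pi>\<close>, this slack is linear on each of six cones; it therefore
  grows linearly away from its zero set, whereas the slack of \<open>d = \<pi>' - \<pi>\<close> vanishes on that set and is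
  Lipschitz. By compactness the slack of \<open>d\<close> is at most a constant multiple of the slack of \<open>\<pi>\<close>,
  so \<open>\<pi> \<plusminus> \<epsilon> d\<close> is valid for small \<open>\<epsilon>\<close>, and extremality forces \<open>d = 0\<close>.
\<close>

section \<open>Finitely supported multiplicities\<close>

lemma weight_eq_sum:
  assumes "finite A" "{r. y r \<noteq> 0} \<subseteq> A"
  shows "weight g y = (\<Sum>r\<in>A. g r * real (y r))"
  unfolding weight_def using assms by (intro sum.mono_neutral_left) auto

lemma finite_support_add:
  fixes y z :: "real \<Rightarrow> nat"
  assumes "finite {r. y r \<noteq> 0}" "finite {r. z r \<noteq> 0}"
  shows "finite {r. y r + z r \<noteq> 0}"
  by (rule finite_subset[OF _ finite_UnI[OF assms]]) auto

lemma weight_add: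
  assumes "finite {r. y r \<noteq> 0}" "finite {r. z r \<noteq> 0}"
  shows "weight g (\<lambda>r. y r + z r) = weight g y + weight g z"
proof -
  let ?A = "{r. y r \<noteq> 0} \<union> {r. z r \<noteq> 0}"
  have "finite ?A" using assms by simp
  moreover have "weight g (\<lambda>r. y r + z r) = (\<Sum>r\<in>?A. g r * real (y r + z r))"
    using assms by (intro weight_eq_sum) auto
  moreover have "weight g y = (\<Sum>r\<in>?A. g r * real (y r))"
    "weight g z = (\<Sum>r\<in>?A. g r * real (z r))"
    using assms by (auto intro!: weight_eq_sum)
  ultimately show ?thesis by (simp add: algebra_simps sum.distrib)
qed

lemma finite_support_times:
  fixes y :: "real \<Rightarrow> nat"
  assumes "finite {r. y r \<noteq> 0}"
  shows "finite {r. n * y r \<noteq> 0}"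
  by (rule finite_subset[OF _ assms]) auto

lemma weight_times:
  assumes "finite {r. y r \<noteq> 0}"
  shows "weight g (\<lambda>r. n * y r) = real n * weight g y"
proof -
  have "weight g (\<lambda>r. n * y r) = (\<Sum>r | y r \<noteq> 0. g r * real (n * y r))"
    using assms by (intro weight_eq_sum) auto
  then show ?thesis by (simp add: weight_def sum_distrib_left mult_ac)
qed

text \<open>Sums of these encode solutions with two or three elements; coinciding elements need no
  case distinction.\<close>

definition single :: "real \<Rightarrow> real \<Rightarrow> nat" where
  "single a r = (if r = a then 1 else 0)"

lemma finite_support_single: "finite {r. single a r \<noteq> 0}"
  by (simp add: single_def)

lemma weight_single: "weight g (single a) = g a"
  by (simp add: weight_def single_def)

lemma finite_support_remove:
  fixes y :: "real \<Rightarrow> nat"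
  assumes "finite {r. y r \<noteq> 0}"
  shows "finite {r. (y(s := n)) r \<noteq> 0}"
  by (rule finite_subset[of _ "insert s {r. y r \<noteq> 0}"]) (use assms in auto)

lemma weight_remove:
  assumes "finite {r. y r \<noteq> 0}"
  shows "weight g y = weight g (y(s := 0)) + g s * real (y s)"
proof -
  let ?A = "insert s {r. y r \<noteq> 0}"
  have "finite ?A" using assms by simp
  have "weight g y = (\<Sum>r\<in>?A. g r * real (y r))"
    using assms by (intro weight_eq_sum) auto
  moreover have "weight g (y(s := 0)) = (\<Sum>r\<in>?A. g r * real ((y(s := 0)) r))"
    using assms by (intro weight_eq_sum) auto
  moreover have "(\<Sum>r\<in>?A. g r * real (y r)) = (\<Sum>r\<in>?A - {s}. g r * real (y r)) + g s * real (y s)"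
    using \<open>finite ?A\<close> by (subst sum.remove[of _ s]) auto
  moreover have "(\<Sum>r\<in>?A. g r * real ((y(s := 0)) r)) = (\<Sum>r\<in>?A - {s}. g r * real (y r))"
    using \<open>finite ?A\<close> by (subst sum.remove[of _ s]) (auto intro!: sum.cong)
  ultimately show ?thesis by simp
qed

lemma weight_nonneg:
  assumes "\<And>r. 0 \<le> g r"
  shows "0 \<le> weight g y"
  unfolding weight_def by (intro sum_nonneg) (simp add: assms)

lemma weight_cong_support:
  assumes "\<And>r. y r \<noteq> 0 \<Longrightarrow> g r = h r"
  shows "weight g y = weight h y"
  unfolding weight_def by (intro sum.cong) (auto simp: assms)

text \<open>Reading the total of \<open>y\<close> as the weight of the identity lets the lemmas on
  \<open>weight\<close> serve feasibility and cost alike.\<close>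

lemma group_feasible_iff:
  "y \<in> group_feasible f \<longleftrightarrow>
     finite {r. y r \<noteq> 0} \<and> weight (\<lambda>r. r) y - f \<in> \<int>"
proof -
  have "(\<exists>k::int. w = f + of_int k) \<longleftrightarrow> w - f \<in> \<int>" for w
    by (auto simp: algebra_simps elim!: Ints_cases)
  then show ?thesis by (simp add: group_feasible_def weight_def)
qed

lemma finite_support_pair: "finite {r. single a r + single b r \<noteq> 0}"
  by (intro finite_support_add finite_support_single)

lemma weight_pair: "weight g (\<lambda>r. single a r + single b r) = g a + g b"
  by (simp only: weight_add[OF finite_support_single finite_support_single] weight_single)

lemma pair_feasible:
  assumes "a + b - f \<in> \<int>"
  shows "(\<lambda>r. single a r + single b r) \<in> group_feasible f"
  using assms finite_support_pair by (simp only: group_feasible_iff weight_pair)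

lemma weight_triple: "weight g (\<lambda>r. single a r + single b r + single c r) = g a + g b + g c"
  by (simp only: weight_add[OF finite_support_pair finite_support_single] weight_pair weight_single)

lemma triple_feasible:
  assumes "a + b + c - f \<in> \<int>"
  shows "(\<lambda>r. single a r + single b r + single c r) \<in> group_feasible f"
  unfolding group_feasible_iff
proof
  show "finite {r. single a r + single b r + single c r \<noteq> 0}"
    by (intro finite_support_add finite_support_single)
  show "weight (\<lambda>r. r) (\<lambda>r. single a r + single b r + single c r) - f \<in> \<int>"
    using assms by (simp only: weight_triple)
qed

section \<open>Minimality of extreme functions\<close>

text \<open>Reflecting \<open>\<rho>\<close> in \<open>\<pi>\<close> gives \<open>?\<sigma>\<close>,
  which lies above \<open>\<pi>\<close> and so is valid as well; \<open>\<pi>\<close> is the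
  midpoint of the two.\<close>

lemma extreme_minimal:
  assumes "extreme_function f \<pi>" "valid_function f \<rho>" "\<And>r. \<rho> r \<le> \<pi> r"
  shows "\<rho> = \<pi>"
proof -
  let ?\<sigma> = "\<lambda>r. 2 * \<pi> r - \<rho> r"
  have "valid_function f \<pi>" using assms(1) by (simp add: extreme_function_def)
  have "valid_function f ?\<sigma>"
    unfolding valid_function_def
  proof (intro conjI allI ballI)
    fix r show "0 \<le> ?\<sigma> r"
      using assms(3)[of r] \<open>valid_function f \<pi>\<close> by (simp add: valid_function_def)
        (smt (verit))
  next
    fix y assume "y \<in> group_feasible f"
    then have "1 \<le> weight \<pi> y" using \<open>valid_function f \<pi>\<close> by (simp add: valid_function_def)
    also have "weight \<pi> y \<le> weight ?\<sigma> y"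
      unfolding weight_def by (intro sum_mono mult_right_mono) (use assms(3) in \<open>auto simp: algebra_simps\<close>)
    finally show "1 \<le> weight ?\<sigma> y" .
  qed
  moreover have "\<pi> = (\<lambda>r. (1/2) * (\<rho> r + ?\<sigma> r))" by (auto simp: field_simps)
  ultimately show ?thesis
    using assms(1,2) unfolding extreme_function_def by blast
qed

text \<open>Subadditivity, periodicity and \<open>\<pi> 0 = 0\<close> are all instances of this, for \<open>z\<close> of total
  multiplicity two, one and zero. If the bound failed at \<open>s\<close>, the value of \<open>\<pi>\<close> there could be lowered
  to \<open>weight \<pi> z\<close>: each occurrence of \<open>s\<close> in a solution can be traded for a copy of \<open>z\<close>.\<close>

lemma extreme_le_weight:
  assumes ext: "extreme_function f \<pi>"
    and z: "finite {r. z r \<noteq> 0}" "weight (\<lambda>r. r) z - s \<in> \<int>"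
  shows "\<pi> s \<le> weight \<pi> z"
proof (rule ccontr)
  assume less: "\<not> \<pi> s \<le> weight \<pi> z"
  have val: "valid_function f \<pi>" using ext by (simp add: extreme_function_def)
  then have nonneg: "0 \<le> \<pi> r" for r by (simp add: valid_function_def)
  have "z s = 0"
  proof (rule ccontr)
    assume "z s \<noteq> 0"
    then have "\<pi> s * 1 \<le> \<pi> s * real (z s)" using nonneg by (intro mult_left_mono) auto
    then show False
      using weight_remove[OF z(1), of \<pi> s] weight_nonneg[of \<pi> "z(s := 0)"] nonneg less by simp
  qed
  define \<rho> where "\<rho> = \<pi>(s := weight \<pi> z)"
  have "valid_function f \<rho>"
    unfolding valid_function_def
  proof (intro conjI allI ballI)
    fix r show "0 \<le> \<rho> r"
      using nonneg weight_nonneg[of \<pi> z] by (simp add: \<rho>_def)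
  next
    fix y assume y: "y \<in> group_feasible f"
    then have fin: "finite {r. y r \<noteq> 0}" by (simp add: group_feasible_iff)
    let ?y = "\<lambda>r. (y(s := 0)) r + y s * z r"
    have wt: "weight g ?y = weight g (y(s := 0)) + real (y s) * weight g z" for g
      using weight_add[OF finite_support_remove[OF fin] finite_support_times[OF z(1)]]
        weight_times[OF z(1)] by (simp only:)
    have fin': "finite {r. ?y r \<noteq> 0}"
      by (rule finite_support_add[OF finite_support_remove[OF fin] finite_support_times[OF z(1)]])
    have "weight (\<lambda>r. r) ?y - f =
        (weight (\<lambda>r. r) y - f) + of_nat (y s) * (weight (\<lambda>r. r) z - s)"
      using weight_remove[OF fin, of "\<lambda>r. r" s] unfolding wt by (simp add: algebra_simps)
    also have "\<dots> \<in> \<int>"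
      using y z(2) by (intro Ints_add Ints_mult) (auto simp: group_feasible_iff)
    finally have "?y \<in> group_feasible f" using fin' by (simp only: group_feasible_iff)
    then have "1 \<le> weight \<pi> ?y" using val unfolding valid_function_def by blast
    also have "\<dots> = weight \<rho> y"
    proof -
      have "weight \<pi> (y(s := 0)) = weight \<rho> (y(s := 0))"
        by (rule weight_cong_support) (auto simp: \<rho>_def split: if_splits)
      then show ?thesis
        unfolding wt using weight_remove[OF fin, of \<rho> s] by (simp add: \<rho>_def)
    qed
    finally show "1 \<le> weight \<rho> y" .
  qed
  then have "\<rho> = \<pi>"
    using less by (intro extreme_minimal[OF ext]) (auto simp: \<rho>_def)
  then have "weight \<pi> z = \<pi> s" by (metis \<rho>_def fun_upd_same)
  then show False using less by simp
qed

lemma extreme_zero: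
  assumes "extreme_function f \<pi>"
  shows "\<pi> 0 = 0"
proof -
  have "\<pi> 0 \<le> weight \<pi> (\<lambda>r. 0)"
    by (rule extreme_le_weight[OF assms]) (auto simp: weight_def)
  moreover have "0 \<le> \<pi> 0" using assms by (simp add: extreme_function_def valid_function_def)
  ultimately show ?thesis by (simp add: weight_def)
qed

lemma extreme_subadditive:
  assumes "extreme_function f \<pi>"
  shows "\<pi> (a + b) \<le> \<pi> a + \<pi> b"
  using extreme_le_weight[OF assms finite_support_pair, of a b "a + b"]
  by (simp add: weight_pair)

lemma extreme_periodic:
  assumes "extreme_function f \<pi>" "k \<in> \<int>"
  shows "\<pi> (r + k) = \<pi> r"
proof (rule antisym)
  show "\<pi> (r + k) \<le> \<pi> r"
    using extreme_le_weight[OF assms(1) finite_support_single, of r "r + k"] assms(2)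
    by (simp add: weight_single)
  show "\<pi> r \<le> \<pi> (r + k)"
    using extreme_le_weight[OF assms(1) finite_support_single, of "r + k" r] assms(2)
    by (simp add: weight_single)
qed

section \<open>Symmetry with respect to \<open>f\<close>\<close>

lemma valid_pair:
  assumes "valid_function f \<pi>"
  shows "1 \<le> \<pi> r + \<pi> (f - r)"
  using assms pair_feasible[of r "f - r" f] weight_pair[of \<pi> r "f - r"]
  unfolding valid_function_def by force

text \<open>If \<open>\<pi> r + \<pi> (f - r) = 1 + \<delta>\<close> with \<open>\<delta> > 0\<close>, the value at \<open>r\<close> could be divided by \<open>1 + \<delta>\<close>: a
  solution using \<open>r\<close> has weight at least \<open>1 + \<delta>\<close>, as the rest of it represents \<open>f - r\<close>.\<close>

lemma extreme_symmetric_pos: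
  assumes ext: "extreme_function f \<pi>" and "0 < \<pi> r"
  shows "\<pi> r + \<pi> (f - r) = 1"
proof (rule ccontr)
  assume neq: "\<pi> r + \<pi> (f - r) \<noteq> 1"
  have val: "valid_function f \<pi>" using ext by (simp add: extreme_function_def)
  then have nonneg: "0 \<le> \<pi> r" for r by (simp add: valid_function_def)
  define t where "t = \<pi> r + \<pi> (f - r)"
  have t: "1 < t" using valid_pair[OF val, of r] neq by (simp add: t_def)
  define \<rho> where "\<rho> = \<pi>(r := \<pi> r / t)"
  have "valid_function f \<rho>"
    unfolding valid_function_def
  proof (intro conjI allI ballI)
    fix q show "0 \<le> \<rho> q" using nonneg t by (simp add: \<rho>_def)
  next
    fix y assume y: "y \<in> group_feasible f"
    then have fin: "finite {q. y q \<noteq> 0}" by (simp add: group_feasible_iff)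
    have rest: "weight \<rho> (y(r := 0)) = weight \<pi> (y(r := 0))"
      by (rule weight_cong_support) (auto simp: \<rho>_def split: if_splits)
    show "1 \<le> weight \<rho> y"
    proof (cases "y r = 0")
      case True
      then have "y(r := 0) = y" by auto
      then show ?thesis using rest y val by (simp add: valid_function_def)
    next
      case False
      \<comment> \<open>One copy of \<open>r\<close> is taken out; what remains has total f - r
        modulo 1.\<close>
      define z where "z = y(r := y r - 1)"
      have finz: "finite {q. z q \<noteq> 0}" unfolding z_def by (rule finite_support_remove[OF fin])
      have z0: "z(r := 0) = y(r := 0)" by (simp add: z_def)
      have zr: "real (z r) = real (y r) - 1" using False by (simp add: z_def of_nat_diff)
      have wz: "weight g z = weight g y - g r" for g
        using weight_remove[OF fin, of g r] weight_remove[OF finz, of g r]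
        unfolding z0 zr by (simp add: algebra_simps)
      have "weight (\<lambda>q. q) z - (f - r) \<in> \<int>"
        using y by (simp add: wz group_feasible_iff algebra_simps)
      then have "\<pi> (f - r) \<le> weight \<pi> z"
        by (rule extreme_le_weight[OF ext finz])
      then have "t \<le> weight \<pi> (y(r := 0)) + \<pi> r * real (y r)"
        using weight_remove[OF fin, of \<pi> r] by (simp add: wz t_def)
      \<comment> \<open>Enlarging only the part away from \<open>r\<close> by \<open>t\<close>
        yields a common factor \<open>t\<close>, because \<open>\<rho>\<close> divides by
        \<open>t\<close> at \<open>r\<close> alone.\<close>
      also have "\<dots> \<le> t * weight \<pi> (y(r := 0)) + \<pi> r * real (y r)"
        using t weight_nonneg[of \<pi> "y(r := 0)"] nonneg
        by (simp add: mult_le_cancel_right1)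
      also have "\<dots> = t * weight \<rho> y"
        using weight_remove[OF fin, of \<rho> r] t unfolding rest
        by (simp add: \<rho>_def field_simps)
      finally show ?thesis using t by simp
    qed
  qed
  moreover have "\<rho> q \<le> \<pi> q" for q
    using t mult_right_mono[of 1 t "\<pi> r"] nonneg[of r] by (simp add: \<rho>_def field_simps)
  ultimately have "\<rho> = \<pi>" by (intro extreme_minimal[OF ext])
  then have "\<pi> r / t = \<pi> r" by (metis \<rho>_def fun_upd_same)
  then show False using t \<open>0 < \<pi> r\<close> by (simp add: field_simps)
qed

text \<open>Where \<pi> vanishes, validity of the pair makes it positive at the reflected point f -
  r, and the relation is invariant under this reflection.\<close>

lemma extreme_symmetric:
  assumes "extreme_function f \<pi>"
  shows "\<pi> r + \<pi> (f - r) = 1"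
proof (cases "0 < \<pi> r")
  case True
  then show ?thesis by (rule extreme_symmetric_pos[OF assms])
next
  case False
  have val: "valid_function f \<pi>" using assms by (simp add: extreme_function_def)
  have "0 < \<pi> (f - r)" using valid_pair[OF val, of r] False by linarith
  from extreme_symmetric_pos[OF assms this] show ?thesis by simp
qed

text \<open>The conditions by which Gomory and Johnson characterize minimal valid functions,
  packaged because both \<pi> and \<pi>' will satisfy them.\<close>

definition gomory_johnson :: "real \<Rightarrow> (real \<Rightarrow> real) \<Rightarrow> bool" where
  "gomory_johnson f g \<longleftrightarrow> (\<forall>x. 0 \<le> g x) \<and> g 0 = 0 \<and> (\<forall>x y. g (x + y) \<le> g x + g y) \<and>
     (\<forall>x. \<forall>k\<in>\<int>. g (x + k) = g x) \<and> (\<forall>x. g x + g (f - x) = 1)"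

lemma gomory_johnsonD:
  assumes "gomory_johnson f g"
  shows "0 \<le> g x" "g x \<le> 1" "g 0 = 0" "g (x + y) \<le> g x + g y"
    "k \<in> \<int> \<Longrightarrow> g (x + k) = g x" "g x + g (f - x) = 1" "g f = 1"
proof -
  have nonneg: "0 \<le> g x" and zero: "g 0 = 0" and sym: "g x + g (f - x) = 1" for x
    using assms by (simp_all add: gomory_johnson_def)
  then show "0 \<le> g x" "g 0 = 0" "g x + g (f - x) = 1" by simp_all
  show "g (x + y) \<le> g x + g y" "k \<in> \<int> \<Longrightarrow> g (x + k) = g x"
    using assms by (simp_all add: gomory_johnson_def)
  show "g x \<le> 1" using sym[of x] nonneg[of "f - x"] by linarith
  show "g f = 1" using sym[of 0] zero by simp
qed

lemma extreme_imp_gomory_johnson: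
  assumes "extreme_function f \<pi>"
  shows "gomory_johnson f \<pi>"
  using extreme_zero extreme_subadditive extreme_periodic extreme_symmetric assms
  unfolding gomory_johnson_def by (auto simp: extreme_function_def valid_function_def)

section \<open>Validity from subadditivity\<close>

lemma subadditive_mult_nat:
  fixes g :: "real \<Rightarrow> real"
  assumes "g 0 = 0" "\<And>x y. g (x + y) \<le> g x + g y"
  shows "g (real n * x) \<le> real n * g x"
proof (induction n)
  case (Suc n)
  then show ?case using assms(2)[of x "real n * x"] by (simp add: algebra_simps)
qed (simp add: assms)

lemma subadditive_sum_le:
  fixes g :: "real \<Rightarrow> real"
  assumes "finite A" "g 0 = 0" "\<And>x y. g (x + y) \<le> g x + g y"
  shows "g (\<Sum>r\<in>A. r * real (y r)) \<le> (\<Sum>r\<in>A. g r * real (y r))"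
  using assms(1)
proof induction
  case (insert a A)
  have "g (real (y a) * a) \<le> real (y a) * g a"
    by (rule subadditive_mult_nat[of g]) (use assms in auto)
  then show ?case
    using insert assms(3)[of "a * real (y a)" "\<Sum>r\<in>A. r * real (y r)"] by (simp add: mult_ac)
qed (simp add: assms)

text \<open>Periodicity gives a solution's total the value g f = 1, and subadditivity bounds this by
  its weight. A lower bound \<open>B\<close> is all that is known in advance of a perturbed
  function, so nonnegativity is derived.\<close>

lemma subadditive_imp_valid:
  assumes "g 0 = 0" and sub: "\<And>x y. g (x + y) \<le> g x + g y"
    and per: "\<And>x k. k \<in> \<int> \<Longrightarrow> g (x + k) = g x"
    and bdd: "\<And>x. B \<le> g x" and "g f = 1"
  shows "valid_function f g"
  unfolding valid_function_def
proof (intro conjI allI ballI)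
  fix x show "0 \<le> g x"
  proof (rule ccontr)
    assume "\<not> 0 \<le> g x"
    \<comment> \<open>A negative value at \<open>x\<close> would push the values at large multiples
      of \<open>x\<close> below \<open>B\<close>.\<close>
    then have "\<forall>y. \<exists>n. y < real n * (- g x)" by (intro reals_Archimedean3) simp
    then obtain n where "- B < real n * (- g x)" by blast
    moreover have "B \<le> real n * g x"
      using bdd[of "real n * x"] subadditive_mult_nat[of g n x] assms(1) sub by force
    ultimately show False by simp
  qed
next
  fix y assume y: "y \<in> group_feasible f"
  then have fin: "finite {r. y r \<noteq> 0}" and "weight (\<lambda>r. r) y - f \<in> \<int>"
    by (auto simp: group_feasible_iff)
  then have "g (weight (\<lambda>r. r) y) = 1"
    using per[of "weight (\<lambda>r. r) y - f" f] assms(5) by simp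
  then show "1 \<le> weight g y"
    using subadditive_sum_le[OF fin, of g y] assms(1) sub by (simp add: weight_def)
qed

section \<open>Functions with a larger tight set\<close>

lemma tight_transfer:
  assumes "tight_set f \<pi> \<subseteq> tight_set f \<pi>'" "y \<in> group_feasible f" "weight \<pi> y = 1"
  shows "weight \<pi>' y = 1"
  using assms by (auto simp: tight_set_def)

lemma tight_pair:
  assumes "tight_set f \<pi> \<subseteq> tight_set f \<pi>'" "a + b - f \<in> \<int>" "\<pi> a + \<pi> b = 1"
  shows "\<pi>' a + \<pi>' b = 1"
  using tight_transfer[OF assms(1) pair_feasible[OF assms(2)]] assms(3) by (simp add: weight_pair)

lemma tight_triple:
  assumes "tight_set f \<pi> \<subseteq> tight_set f \<pi>'" "a + b + c - f \<in> \<int>" "\<pi> a + \<pi> b + \<pi> c = 1"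
  shows "\<pi>' a + \<pi>' b + \<pi>' c = 1"
  using tight_transfer[OF assms(1) triple_feasible[OF assms(2)]] assms(3) by (simp add: weight_triple)

text \<open>By symmetry at a + b, additivity at (a, b) says that the triple a, b, f - (a + b) is
  tight. This triple and the symmetric pair at a + b stay tight for \<pi>'; subtracting the two
  equations gives the claim.\<close>

lemma tight_additive:
  assumes gj: "gomory_johnson f \<pi>" and sub: "tight_set f \<pi> \<subseteq> tight_set f \<pi>'"
    and "\<pi> (a + b) = \<pi> a + \<pi> b"
  shows "\<pi>' (a + b) = \<pi>' a + \<pi>' b"
proof -
  have "\<pi> a + \<pi> b + \<pi> (f - (a + b)) = 1"
    using gomory_johnsonD(6)[OF gj, of "a + b"] assms(3) by simp
  then have "\<pi>' a + \<pi>' b + \<pi>' (f - (a + b)) = 1"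
    by (intro tight_triple[OF sub]) auto
  moreover have "\<pi>' (a + b) + \<pi>' (f - (a + b)) = 1"
    by (rule tight_pair[OF sub]) (auto simp: gomory_johnsonD(6)[OF gj])
  ultimately show ?thesis by simp
qed

text \<open>Symmetry and periodicity come from tight pairs, the latter from the pair x + k, f - x.
  Subadditivity is an inequality and cannot be transferred this way; it follows from the validity of
  \<pi>' on triples together with its symmetry.\<close>

lemma tight_gomory_johnson:
  assumes gj: "gomory_johnson f \<pi>" and sub: "tight_set f \<pi> \<subseteq> tight_set f \<pi>'"
    and val: "valid_function f \<pi>'"
  shows "gomory_johnson f \<pi>'"
proof -
  have sym: "\<pi>' x + \<pi>' (f - x) = 1" for x
    by (rule tight_pair[OF sub]) (auto simp: gomory_johnsonD(6)[OF gj])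
  have per: "\<pi>' (x + k) = \<pi>' x" if "k \<in> \<int>" for x k
  proof -
    have "\<pi>' (x + k) + \<pi>' (f - x) = 1"
      using that gomory_johnsonD(5)[OF gj that, of x] gomory_johnsonD(6)[OF gj, of x]
      by (intro tight_pair[OF sub]) auto
    then show ?thesis using sym[of x] by simp
  qed
  have subadd: "\<pi>' (x + y) \<le> \<pi>' x + \<pi>' y" for x y
  proof -
    have "1 \<le> \<pi>' x + \<pi>' y + \<pi>' (f - (x + y))"
      using val triple_feasible[of x y "f - (x + y)" f] weight_triple[of \<pi>' x y "f - (x + y)"]
      unfolding valid_function_def by force
    then show ?thesis using sym[of "x + y"] by simp
  qed
  \<comment> \<open>Additivity of \<pi> at (0, 0) transfers, so \<pi>' 0 equals its own
    double.\<close>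
  have "\<pi>' 0 = 0"
    using tight_additive[OF gj sub, of 0 0] gomory_johnsonD(3)[OF gj] by simp
  then show ?thesis
    using sym per subadd val by (simp add: gomory_johnson_def valid_function_def)
qed

section \<open>Local structure of piecewise linear functions\<close>

text \<open>By local finiteness, some cell contains infinitely many terms of a sequence tending to
  \<open>x\<close> in direction \<sigma>. Being closed it contains \<open>x\<close>, and being
  convex it contains a whole segment starting at \<open>x\<close>.\<close>

lemma cpl_linear_to:
  fixes \<pi> :: "real \<Rightarrow> real" and \<sigma> :: real
  assumes "continuous_piecewise_linear \<pi>"
  obtains \<delta> s where "0 < \<delta>" "\<And>t. 0 \<le> t \<Longrightarrow> t \<le> \<delta> \<Longrightarrow> \<pi> (x + \<sigma> * t) = \<pi> x + s * t"
proof -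
  obtain \<P> where poly: "polyhedral_complex \<P>" and lf: "locally_finite_cells \<P>"
    and cov: "\<Union>\<P> = UNIV" and aff: "\<forall>I\<in>\<P>. \<exists>a b. \<forall>x\<in>I. \<pi> x = a * x + b"
    using assms by (auto simp: continuous_piecewise_linear_def)
  define p where "p n = x + \<sigma> * (1 / real (Suc n))" for n
  have lim: "p \<longlonglongrightarrow> x + \<sigma> * 0"
    unfolding p_def by (intro tendsto_intros LIMSEQ_Suc[OF lim_1_over_n])
  then have "bounded (range p)" using convergent_imp_bounded by blast
  then have fin: "finite {I\<in>\<P>. I \<inter> range p \<noteq> {}}" (is "finite ?C")
    using lf by (simp add: locally_finite_cells_def)
  obtain c where c: "\<And>n. c n \<in> \<P> \<and> p n \<in> c n"
  proof -
    have "\<forall>n. \<exists>I. I \<in> \<P> \<and> p n \<in> I" using cov by blast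
    then show ?thesis using that by metis
  qed
  then have "range c \<subseteq> ?C" by auto
  then have "finite (range c)" using fin finite_subset by blast
  then obtain n0 where "infinite {n. c n = c n0}"
    using pigeonhole_infinite[of UNIV c] by auto
  define I where "I = c n0"
  have often: "infinite {n. p n \<in> I}"
    by (rule infinite_super[OF _ \<open>infinite {n. c n = c n0}\<close>]) (use c in \<open>auto simp: I_def\<close>)
  have I: "I \<in> \<P>" using c by (simp add: I_def)
  have "polyhedron I" using poly I by (simp add: polyhedral_complex_def)
  then have "closed I" "convex I"
    by (auto intro: polyhedron_imp_closed polyhedron_imp_convex)
  have "x \<in> I"
  proof (rule ccontr)
    assume "x \<notin> I"
    then have "open (- I)" "x + \<sigma> * 0 \<in> - I" using \<open>closed I\<close> by auto
    then have "\<forall>\<^sub>F n in sequentially. p n \<in> - I" using lim topological_tendstoD by blast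
    then have "finite {n. p n \<in> I}"
      by (simp add: eventually_cofinite flip: cofinite_eq_sequentially)
    then show False using often by simp
  qed
  obtain n where n: "p n \<in> I" using often not_finite_existsD by blast
  obtain a b where ab: "\<And>x. x \<in> I \<Longrightarrow> \<pi> x = a * x + b" using aff I by blast
  show thesis
  \<comment> \<open>The segment ends at \<open>p n\<close>, which lies in \<open>I\<close>; with
    respect to \<open>t\<close>, the slope \<open>a\<close> of the cell is scaled by
    \<sigma>.\<close>
  proof (rule that[of "1 / real (Suc n)" "a * \<sigma>"])
    fix t assume t: "0 \<le> t" "t \<le> 1 / real (Suc n)"
    define u where "u = t * real (Suc n)"
    have "0 \<le> u" "u \<le> 1" using t by (auto simp: u_def field_simps)
    have "(1 - u) *\<^sub>R x + u *\<^sub>R p n \<in> I"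
      using \<open>convex I\<close> \<open>x \<in> I\<close> n \<open>0 \<le> u\<close> \<open>u \<le> 1\<close> by (intro convexD) auto
    also have "(1 - u) *\<^sub>R x + u *\<^sub>R p n = x + \<sigma> * t"
      by (simp add: p_def u_def field_simps)
    finally show "\<pi> (x + \<sigma> * t) = \<pi> x + a * \<sigma> * t"
      using ab \<open>x \<in> I\<close> by (simp add: algebra_simps)
  qed simp
qed

lemma cpl_two_sided:
  assumes "continuous_piecewise_linear \<pi>"
  obtains \<delta> s s' where "0 < \<delta>"
    "\<And>t. 0 \<le> t \<Longrightarrow> t \<le> \<delta> \<Longrightarrow> \<pi> (x + t) = \<pi> x + s * t"
    "\<And>t. 0 \<le> t \<Longrightarrow> t \<le> \<delta> \<Longrightarrow> \<pi> (x - t) = \<pi> x + s' * t"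
proof -
  obtain \<delta>1 s1 where 1: "0 < \<delta>1" "\<And>t. 0 \<le> t \<Longrightarrow> t \<le> \<delta>1 \<Longrightarrow> \<pi> (x + 1 * t) = \<pi> x + s1 * t"
    using cpl_linear_to[OF assms, of x 1] by blast
  obtain \<delta>2 s2 where 2: "0 < \<delta>2" "\<And>t. 0 \<le> t \<Longrightarrow> t \<le> \<delta>2 \<Longrightarrow> \<pi> (x + (-1) * t) = \<pi> x + s2 * t"
    using cpl_linear_to[OF assms, of x "-1"] by blast
  show thesis
    by (rule that[of "min \<delta>1 \<delta>2" s1 s2]) (use 1 2 in auto)
qed

text \<open>If n x is the last multiple of \<open>x\<close> within \<epsilon>, then n * g x = g (n
  x) is at most 1, while n x is at least \<epsilon> / 2. Beyond \<epsilon> the right-hand side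
  exceeds 1 anyway.\<close>

lemma additive_le_linear:
  fixes g :: "real \<Rightarrow> real"
  assumes "0 < \<epsilon>" "\<And>x. g x \<le> 1" "g 0 = 0"
    and add: "\<And>x y. 0 \<le> x \<Longrightarrow> 0 \<le> y \<Longrightarrow> x + y \<le> \<epsilon> \<Longrightarrow> g (x + y) = g x + g y"
    and "0 \<le> x"
  shows "g x \<le> 2 / \<epsilon> * x"
proof (cases "x = 0 \<or> \<epsilon> < x")
  case True
  then show ?thesis
  proof
    assume "\<epsilon> < x"
    then have "1 \<le> 2 / \<epsilon> * x" using assms(1) by (simp add: field_simps)
    then show ?thesis using assms(2)[of x] by linarith
  qed (simp add: assms)
next
  case False
  then have x: "0 < x" "x \<le> \<epsilon>" using assms(5) by auto
  have mult: "real n * x \<le> \<epsilon> \<Longrightarrow> g (real n * x) = real n * g x" for n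
  proof (induction n)
    case (Suc n)
    then have "x + real n * x \<le> \<epsilon>" by (simp add: algebra_simps)
    then have "g (x + real n * x) = g x + g (real n * x)" using x by (intro add) auto
    with Suc x \<open>x + real n * x \<le> \<epsilon>\<close> show ?case by (simp add: algebra_simps)
  qed (simp add: assms)
  define n where "n = nat \<lfloor>\<epsilon> / x\<rfloor>"
  have q: "1 \<le> \<epsilon> / x" using x by simp
  have n: "real n \<le> \<epsilon> / x" "\<epsilon> / x < real n + 1" "1 \<le> real n"
    using q by (auto simp: n_def)
  then have "real n * x \<le> \<epsilon>" using x by (simp add: field_simps)
  then have "real n * g x \<le> 1" using mult assms(2) by metis
  \<comment> \<open>Maximality of \<open>n\<close> gives \<epsilon> < (n + 1) x, and n + 1 \<le> 2 n
    since n is at least 1; hence the factor 2.\<close>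
  moreover have "\<epsilon> \<le> 2 * real n * x"
  proof -
    have "\<epsilon> < (real n + 1) * x" using n(2) x by (simp add: field_simps)
    also have "\<dots> \<le> (2 * real n) * x" using n(3) x by (intro mult_right_mono) auto
    finally show ?thesis by simp
  qed
  moreover have "real n * (\<epsilon> * g x) \<le> real n * (2 * x)"
  proof -
    have "\<epsilon> * (real n * g x) \<le> \<epsilon>" using \<open>real n * g x \<le> 1\<close> assms(1) by simp
    with calculation(2) show ?thesis by (simp only: mult_ac)
  qed
  ultimately have "\<epsilon> * g x \<le> 2 * x" using n(3) by simp
  then show ?thesis using assms(1) by (simp add: field_simps)
qed

text \<open>A linear bound at 0 becomes a global one because \<pi>' x - \<pi>' y \<le> \<pi>' (x -
  y). Taking \<pi>' = \<pi> covers \<pi> itself.\<close>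

lemma tight_lipschitz:
  assumes gj: "gomory_johnson f \<pi>" and sub: "tight_set f \<pi> \<subseteq> tight_set f \<pi>'"
    and gj': "gomory_johnson f \<pi>'" and cpl: "continuous_piecewise_linear \<pi>"
  obtains L where "0 \<le> L" "\<And>x y. \<bar>\<pi>' x - \<pi>' y\<bar> \<le> L * \<bar>x - y\<bar>"
proof -
  note zero = gomory_johnsonD(3)[OF gj]
  obtain \<epsilon> s s' where \<epsilon>: "0 < \<epsilon>"
    "\<And>t. 0 \<le> t \<Longrightarrow> t \<le> \<epsilon> \<Longrightarrow> \<pi> (0 + t) = \<pi> 0 + s * t"
    "\<And>t. 0 \<le> t \<Longrightarrow> t \<le> \<epsilon> \<Longrightarrow> \<pi> (0 - t) = \<pi> 0 + s' * t"
    using cpl_two_sided[OF cpl, of 0] by blast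
  have right: "\<pi>' x \<le> 2 / \<epsilon> * x" if "0 \<le> x" for x
  proof (rule additive_le_linear[OF \<epsilon>(1) _ _ _ that])
    fix x y :: real assume "0 \<le> x" "0 \<le> y" "x + y \<le> \<epsilon>"
    then show "\<pi>' (x + y) = \<pi>' x + \<pi>' y"
      using \<epsilon>(2)[of x] \<epsilon>(2)[of y] \<epsilon>(2)[of "x + y"] zero
      by (intro tight_additive[OF gj sub]) (auto simp: algebra_simps)
  qed (simp_all add: gomory_johnsonD(2,3)[OF gj'])
  have left: "\<pi>' (- x) \<le> 2 / \<epsilon> * x" if "0 \<le> x" for x
  proof (rule additive_le_linear[OF \<epsilon>(1) _ _ _ that])
    fix x y :: real assume "0 \<le> x" "0 \<le> y" "x + y \<le> \<epsilon>"
    then have "\<pi>' (- x + - y) = \<pi>' (- x) + \<pi>' (- y)"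
      using \<epsilon>(3)[of x] \<epsilon>(3)[of y] \<epsilon>(3)[of "x + y"] zero
      by (intro tight_additive[OF gj sub]) (auto simp: algebra_simps)
    then show "\<pi>' (- (x + y)) = \<pi>' (- x) + \<pi>' (- y)" by (simp add: algebra_simps)
  qed (simp_all add: gomory_johnsonD(2,3)[OF gj'])
  have abs: "\<pi>' h \<le> 2 / \<epsilon> * \<bar>h\<bar>" for h
    using right[of h] left[of "- h"] by (cases "0 \<le> h") auto
  show thesis
  proof (rule that[of "2 / \<epsilon>"])
    fix x y
    have "\<pi>' x \<le> \<pi>' y + 2 / \<epsilon> * \<bar>x - y\<bar>" for x y
      using gomory_johnsonD(4)[OF gj', of y "x - y"] abs[of "x - y"] by simp
    from this[of x y] this[of y x] show "\<bar>\<pi>' x - \<pi>' y\<bar> \<le> 2 / \<epsilon> * \<bar>x - y\<bar>"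
      by (simp add: abs_minus_commute abs_le_iff)
  qed (use \<epsilon>(1) in simp)
qed

section \<open>Comparing subadditivity slacks\<close>

text \<open>This is linear in \<open>g\<close>, so subadditivity of a perturbation of \<pi> becomes
  a comparison of two slacks.\<close>

definition slack :: "(real \<Rightarrow> real) \<Rightarrow> real \<Rightarrow> real \<Rightarrow> real" where
  "slack g x y = g x + g y - g (x + y)"

lemma slack_lipschitz:
  assumes "0 \<le> L" "\<And>x y. \<bar>d x - d y\<bar> \<le> L * \<bar>x - y\<bar>"
  shows "\<bar>slack d x y - slack d x' y'\<bar> \<le> 2 * L * (\<bar>x - x'\<bar> + \<bar>y - y'\<bar>)"
proof -
  have "\<bar>d (x + y) - d (x' + y')\<bar> \<le> L * (\<bar>x - x'\<bar> + \<bar>y - y'\<bar>)"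
    using assms(2)[of "x + y" "x' + y'"] assms(1)
    by (meson abs_triangle_ineq4 order_trans mult_left_mono abs_diff_triangle_ineq)
  moreover have "\<bar>d x - d x'\<bar> + \<bar>d y - d y'\<bar> \<le> L * (\<bar>x - x'\<bar> + \<bar>y - y'\<bar>)"
    using assms(2)[of x x'] assms(2)[of y y'] by (simp add: algebra_simps)
  ultimately show ?thesis unfolding slack_def by linarith
qed

text \<open>The generators along which the slack of \<open>g\<close> vanishes span its zero set in the cone, and the
  coordinates along the others bound the distance to that set.\<close>

lemma slack_bound_cone:
  fixes a\<^sub>1 b\<^sub>1 a\<^sub>2 b\<^sub>2 :: real
  assumes lin: "\<And>\<alpha> \<beta>. 0 \<le> \<alpha> \<Longrightarrow> 0 \<le> \<beta> \<Longrightarrow> \<alpha> + \<beta> \<le> \<delta> \<Longrightarrow>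
      slack g (x + (a\<^sub>1 * \<alpha> + a\<^sub>2 * \<beta>)) (y + (b\<^sub>1 * \<alpha> + b\<^sub>2 * \<beta>)) = A * \<alpha> + B * \<beta>"
    and "0 < \<delta>" and nonneg: "\<And>x y. 0 \<le> slack g x y"
    and zero: "\<And>x y. slack g x y = 0 \<Longrightarrow> slack d x y = 0"
    and L: "0 \<le> L" "\<And>x y. \<bar>d x - d y\<bar> \<le> L * \<bar>x - y\<bar>"
    and unit: "\<bar>a\<^sub>1\<bar> \<le> 1" "\<bar>b\<^sub>1\<bar> \<le> 1" "\<bar>a\<^sub>2\<bar> \<le> 1" "\<bar>b\<^sub>2\<bar> \<le> 1"
  shows "\<exists>M\<ge>0. \<forall>\<alpha> \<beta>. 0 \<le> \<alpha> \<longrightarrow> 0 \<le> \<beta> \<longrightarrow> \<alpha> + \<beta> \<le> \<delta> \<longrightarrow>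
      \<bar>slack d (x + (a\<^sub>1 * \<alpha> + a\<^sub>2 * \<beta>)) (y + (b\<^sub>1 * \<alpha> + b\<^sub>2 * \<beta>))\<bar> \<le>
      M * slack g (x + (a\<^sub>1 * \<alpha> + a\<^sub>2 * \<beta>)) (y + (b\<^sub>1 * \<alpha> + b\<^sub>2 * \<beta>))"
proof -
  define G where "G \<alpha> \<beta> = slack g (x + (a\<^sub>1 * \<alpha> + a\<^sub>2 * \<beta>)) (y + (b\<^sub>1 * \<alpha> + b\<^sub>2 * \<beta>))" for \<alpha> \<beta>
  define H where "H \<alpha> \<beta> = slack d (x + (a\<^sub>1 * \<alpha> + a\<^sub>2 * \<beta>)) (y + (b\<^sub>1 * \<alpha> + b\<^sub>2 * \<beta>))" for \<alpha> \<beta>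
  have G: "G \<alpha> \<beta> = A * \<alpha> + B * \<beta>" if "0 \<le> \<alpha>" "0 \<le> \<beta>" "\<alpha> + \<beta> \<le> \<delta>" for \<alpha> \<beta>
    using lin[OF that] by (simp add: G_def)
  have G0: "0 \<le> G \<alpha> \<beta>" for \<alpha> \<beta> by (simp add: G_def nonneg)
  have H0: "H \<alpha> \<beta> = 0" if "G \<alpha> \<beta> = 0" for \<alpha> \<beta> using that zero by (simp add: G_def H_def)
  \<comment> \<open>The slack is nonnegative at the far ends of both generators, so neither slope is
    negative.\<close>
  have "0 \<le> A * \<delta>" "0 \<le> B * \<delta>" using G0[of \<delta> 0] G0[of 0 \<delta>] G[of \<delta> 0] G[of 0 \<delta>] assms(2) by auto
  then have AB: "0 \<le> A" "0 \<le> B" using assms(2) by (auto simp: zero_le_mult_iff)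
  have bnd: "\<bar>p * u + q * v\<bar> \<le> \<bar>u\<bar> + \<bar>v\<bar>" if "\<bar>p\<bar> \<le> 1" "\<bar>q\<bar> \<le> 1" for p q u v :: real
  proof -
    have "\<bar>p * u\<bar> \<le> 1 * \<bar>u\<bar>" "\<bar>q * v\<bar> \<le> 1 * \<bar>v\<bar>"
      unfolding abs_mult by (intro mult_right_mono that abs_ge_zero)+
    then show ?thesis by linarith
  qed
  \<comment> \<open>\<open>slack_lipschitz\<close> contributes 2 L, and another factor 2 arises
    because a change of \<alpha> and \<beta> may move both arguments of the slack.\<close>
  define K where "K = 4 * L"
  have "0 \<le> K" using L by (simp add: K_def)
  have H: "\<bar>H \<alpha> \<beta> - H \<alpha>' \<beta>'\<bar> \<le> K * (\<bar>\<alpha> - \<alpha>'\<bar> + \<bar>\<beta> - \<beta>'\<bar>)" for \<alpha> \<beta> \<alpha>' \<beta>'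
  proof -
    have "\<bar>(x + (a\<^sub>1 * \<alpha> + a\<^sub>2 * \<beta>)) - (x + (a\<^sub>1 * \<alpha>' + a\<^sub>2 * \<beta>'))\<bar> \<le> \<bar>\<alpha> - \<alpha>'\<bar> + \<bar>\<beta> - \<beta>'\<bar>"
      using bnd[OF unit(1,3), of "\<alpha> - \<alpha>'" "\<beta> - \<beta>'"] by (simp add: algebra_simps)
    moreover have "\<bar>(y + (b\<^sub>1 * \<alpha> + b\<^sub>2 * \<beta>)) - (y + (b\<^sub>1 * \<alpha>' + b\<^sub>2 * \<beta>'))\<bar> \<le> \<bar>\<alpha> - \<alpha>'\<bar> + \<bar>\<beta> - \<beta>'\<bar>"
      using bnd[OF unit(2,4), of "\<alpha> - \<alpha>'" "\<beta> - \<beta>'"] by (simp add: algebra_simps)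
    ultimately have two: "\<bar>(x + (a\<^sub>1 * \<alpha> + a\<^sub>2 * \<beta>)) - (x + (a\<^sub>1 * \<alpha>' + a\<^sub>2 * \<beta>'))\<bar> +
        \<bar>(y + (b\<^sub>1 * \<alpha> + b\<^sub>2 * \<beta>)) - (y + (b\<^sub>1 * \<alpha>' + b\<^sub>2 * \<beta>'))\<bar> \<le> 2 * (\<bar>\<alpha> - \<alpha>'\<bar> + \<bar>\<beta> - \<beta>'\<bar>)"
      unfolding mult_2 by (rule add_mono)
    show ?thesis
      unfolding H_def K_def
      using order_trans[OF slack_lipschitz[OF L] mult_left_mono[OF two, of "2 * L"]] L(1)
      by (simp add: algebra_simps)
  qed
  have "\<exists>M\<ge>0. \<forall>\<alpha> \<beta>. 0 \<le> \<alpha> \<longrightarrow> 0 \<le> \<beta> \<longrightarrow> \<alpha> + \<beta> \<le> \<delta> \<longrightarrow> \<bar>H \<alpha> \<beta>\<bar> \<le> M * G \<alpha> \<beta>"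
  proof -
    define M where "M = (if A = 0 then 0 else K / A) + (if B = 0 then 0 else K / B)"
    have "0 \<le> M" using AB \<open>0 \<le> K\<close> by (simp add: M_def)
    moreover have "\<bar>H \<alpha> \<beta>\<bar> \<le> M * G \<alpha> \<beta>" if ab: "0 \<le> \<alpha>" "0 \<le> \<beta>" "\<alpha> + \<beta> \<le> \<delta>" for \<alpha> \<beta>
    proof -
      \<comment> \<open>The coordinates with positive slope are set to 0, which leads to a zero of
        \<open>G\<close> and hence of \<open>H\<close>. The distance moved is the sum of the dropped
        coordinates, each paid for by its term K / A or K / B in \<open>M\<close>.\<close>
      define \<alpha>' \<beta>' where "\<alpha>' = (if A = 0 then \<alpha> else 0)" and "\<beta>' = (if B = 0 then \<beta> else 0)"
      have "G \<alpha>' \<beta>' = 0" using ab by (subst G) (auto simp: \<alpha>'_def \<beta>'_def)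
      then have "\<bar>H \<alpha> \<beta>\<bar> \<le> K * (\<bar>\<alpha> - \<alpha>'\<bar> + \<bar>\<beta> - \<beta>'\<bar>)" using H[of \<alpha> \<beta> \<alpha>' \<beta>'] H0 by simp
      also have "\<dots> \<le> M * (A * \<alpha> + B * \<beta>)"
      proof -
        have "K * \<bar>\<alpha> - \<alpha>'\<bar> \<le> M * (A * \<alpha>)"
        proof (cases "A = 0")
          case False
          then have "K / A * (A * \<alpha>) \<le> M * (A * \<alpha>)"
            using AB ab \<open>0 \<le> K\<close> by (intro mult_right_mono) (auto simp: M_def)
          then show ?thesis using False ab by (simp add: \<alpha>'_def)
        qed (simp add: \<alpha>'_def)
        moreover have "K * \<bar>\<beta> - \<beta>'\<bar> \<le> M * (B * \<beta>)"
        proof (cases "B = 0")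
          case False
          then have "K / B * (B * \<beta>) \<le> M * (B * \<beta>)"
            using AB ab \<open>0 \<le> K\<close> by (intro mult_right_mono) (auto simp: M_def)
          then show ?thesis using False ab by (simp add: \<beta>'_def)
        qed (simp add: \<beta>'_def)
        ultimately show ?thesis by (simp add: algebra_simps)
      qed
      finally show ?thesis using G[OF ab] by simp
    qed
    ultimately show ?thesis by blast
  qed
  then show ?thesis unfolding G_def H_def .
qed

text \<open>Near (x, y) the slack can bend only along the lines u = 0, v = 0 and u + v = 0. They cut
  the plane into six cones, and \<open>slack_bound_cone\<close> applies to each.\<close>

lemma slack_bound_at_zero:
  assumes cpl: "continuous_piecewise_linear g"
    and nonneg: "\<And>x y. 0 \<le> slack g x y"
    and zero: "\<And>x y. slack g x y = 0 \<Longrightarrow> slack d x y = 0"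
    and L: "0 \<le> L" "\<And>x y. \<bar>d x - d y\<bar> \<le> L * \<bar>x - y\<bar>"
    and at: "slack g x y = 0"
  shows "\<exists>\<epsilon>>0. \<exists>M. \<forall>u v. \<bar>u\<bar> < \<epsilon> \<longrightarrow> \<bar>v\<bar> < \<epsilon> \<longrightarrow>
     \<bar>slack d (x + u) (y + v)\<bar> \<le> M * slack g (x + u) (y + v)"
proof -
  obtain \<delta>1 p p' where 1: "0 < \<delta>1"
    "\<And>t. 0 \<le> t \<Longrightarrow> t \<le> \<delta>1 \<Longrightarrow> g (x + t) = g x + p * t"
    "\<And>t. 0 \<le> t \<Longrightarrow> t \<le> \<delta>1 \<Longrightarrow> g (x - t) = g x + p' * t"
    using cpl_two_sided[OF cpl, of x] by blast
  obtain \<delta>2 q q' where 2: "0 < \<delta>2"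
    "\<And>t. 0 \<le> t \<Longrightarrow> t \<le> \<delta>2 \<Longrightarrow> g (y + t) = g y + q * t"
    "\<And>t. 0 \<le> t \<Longrightarrow> t \<le> \<delta>2 \<Longrightarrow> g (y - t) = g y + q' * t"
    using cpl_two_sided[OF cpl, of y] by blast
  obtain \<delta>3 r r' where 3: "0 < \<delta>3"
    "\<And>t. 0 \<le> t \<Longrightarrow> t \<le> \<delta>3 \<Longrightarrow> g (x + y + t) = g (x + y) + r * t"
    "\<And>t. 0 \<le> t \<Longrightarrow> t \<le> \<delta>3 \<Longrightarrow> g (x + y - t) = g (x + y) + r' * t"
    using cpl_two_sided[OF cpl, of "x + y"] by blast
  define \<delta> where "\<delta> = min \<delta>1 (min \<delta>2 \<delta>3)"
  have \<delta>: "0 < \<delta>" using 1 2 3 by (simp add: \<delta>_def)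
  \<comment> \<open>\<open>p'\<close>, \<open>q'\<close> and \<open>r'\<close> are slopes with
    respect to the distance to the left, hence the minus sign for negative arguments.\<close>
  define P where "P u = (if 0 \<le> u then p * u else - p' * u)" for u
  define Q where "Q u = (if 0 \<le> u then q * u else - q' * u)" for u
  define R where "R u = (if 0 \<le> u then r * u else - r' * u)" for u
  \<comment> \<open>The constant terms cancel because the slack at (x, y) is 0.\<close>
  have loc: "slack g (x + u) (y + v) = P u + Q v - R (u + v)"
    if "\<bar>u\<bar> \<le> \<delta>" "\<bar>v\<bar> \<le> \<delta>" "\<bar>u + v\<bar> \<le> \<delta>" for u v
  proof -
    have "g (x + u) = g x + P u"
      using that 1(2)[of u] 1(3)[of "- u"] by (auto simp: P_def \<delta>_def)
    moreover have "g (y + v) = g y + Q v"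
      using that 2(2)[of v] 2(3)[of "- v"] by (auto simp: Q_def \<delta>_def)
    moreover have "g (x + y + (u + v)) = g (x + y) + R (u + v)"
    proof (cases "0 \<le> u + v")
      case True
      then show ?thesis using that 3(2)[of "u + v"] by (simp add: R_def \<delta>_def)
    next
      case False
      moreover have "x + y - - (u + v) = x + y + (u + v)" by simp
      moreover have "g (x + y - - (u + v)) = g (x + y) + r' * - (u + v)"
        using False that(3) by (intro 3(3)) (auto simp: \<delta>_def)
      ultimately show ?thesis by (simp only: R_def if_False minus_mult_left minus_mult_right)
    qed
    moreover have "(x + u) + (y + v) = x + y + (u + v)" by simp
    ultimately show ?thesis using at unfolding slack_def by (simp only:)
  qed
  have P: "P t = p * t" if "0 \<le> t" for t using that by (simp add: P_def)
  have P': "P t = - p' * t" if "t \<le> 0" for t using that by (auto simp: P_def)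
  have Q: "Q t = q * t" if "0 \<le> t" for t using that by (simp add: Q_def)
  have Q': "Q t = - q' * t" if "t \<le> 0" for t using that by (auto simp: Q_def)
  have R: "R t = r * t" if "0 \<le> t" for t using that by (simp add: R_def)
  have R': "R t = - r' * t" if "t \<le> 0" for t using that by (auto simp: R_def)
  \<comment> \<open>Each quadruple lists the two generators \<open>(a\<^sub>1, b\<^sub>1)\<close>
    and \<open>(a\<^sub>2, b\<^sub>2)\<close> of one cone.\<close>
  define C :: "(real \<times> real \<times> real \<times> real) set" where
    "C = {(1,0,0,1), (-1,0,0,-1), (1,-1,0,-1), (-1,1,0,1), (-1,1,-1,0), (1,-1,1,0)}"
  define bounded_on where "bounded_on = (\<lambda>(a\<^sub>1, b\<^sub>1, a\<^sub>2, b\<^sub>2) M.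
    \<forall>\<alpha> \<beta>. 0 \<le> \<alpha> \<longrightarrow> 0 \<le> \<beta> \<longrightarrow> \<alpha> + \<beta> \<le> \<delta> \<longrightarrow>
      \<bar>slack d (x + (a\<^sub>1 * \<alpha> + a\<^sub>2 * \<beta>)) (y + (b\<^sub>1 * \<alpha> + b\<^sub>2 * \<beta>))\<bar> \<le>
      M * slack g (x + (a\<^sub>1 * \<alpha> + a\<^sub>2 * \<beta>)) (y + (b\<^sub>1 * \<alpha> + b\<^sub>2 * \<beta>)))"
  have "\<forall>c\<in>C. \<exists>M. 0 \<le> M \<and> bounded_on c M"
  proof
    fix c assume "c \<in> C"
    obtain a\<^sub>1 b\<^sub>1 a\<^sub>2 b\<^sub>2 where c: "c = (a\<^sub>1, b\<^sub>1, a\<^sub>2, b\<^sub>2)" by (cases c)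
    have cases: "(a\<^sub>1 = 1 \<and> b\<^sub>1 = 0 \<and> a\<^sub>2 = 0 \<and> b\<^sub>2 = 1) \<or> (a\<^sub>1 = -1 \<and> b\<^sub>1 = 0 \<and> a\<^sub>2 = 0 \<and> b\<^sub>2 = -1) \<or>
      (a\<^sub>1 = 1 \<and> b\<^sub>1 = -1 \<and> a\<^sub>2 = 0 \<and> b\<^sub>2 = -1) \<or> (a\<^sub>1 = -1 \<and> b\<^sub>1 = 1 \<and> a\<^sub>2 = 0 \<and> b\<^sub>2 = 1) \<or>
      (a\<^sub>1 = -1 \<and> b\<^sub>1 = 1 \<and> a\<^sub>2 = -1 \<and> b\<^sub>2 = 0) \<or> (a\<^sub>1 = 1 \<and> b\<^sub>1 = -1 \<and> a\<^sub>2 = 1 \<and> b\<^sub>2 = 0)"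
      using \<open>c \<in> C\<close> by (simp add: C_def c)
    have "\<exists>M\<ge>0. \<forall>\<alpha> \<beta>. 0 \<le> \<alpha> \<longrightarrow> 0 \<le> \<beta> \<longrightarrow> \<alpha> + \<beta> \<le> \<delta> \<longrightarrow>
      \<bar>slack d (x + (a\<^sub>1 * \<alpha> + a\<^sub>2 * \<beta>)) (y + (b\<^sub>1 * \<alpha> + b\<^sub>2 * \<beta>))\<bar> \<le>
      M * slack g (x + (a\<^sub>1 * \<alpha> + a\<^sub>2 * \<beta>)) (y + (b\<^sub>1 * \<alpha> + b\<^sub>2 * \<beta>))"
    proof (rule slack_bound_cone[OF _ \<delta> nonneg zero L])
      fix \<alpha> \<beta> :: real assume pos: "0 \<le> \<alpha>" "0 \<le> \<beta>" "\<alpha> + \<beta> \<le> \<delta>"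
      have "\<bar>a\<^sub>1 * \<alpha> + a\<^sub>2 * \<beta>\<bar> \<le> \<delta>" "\<bar>b\<^sub>1 * \<alpha> + b\<^sub>2 * \<beta>\<bar> \<le> \<delta>"
        "\<bar>(a\<^sub>1 * \<alpha> + a\<^sub>2 * \<beta>) + (b\<^sub>1 * \<alpha> + b\<^sub>2 * \<beta>)\<bar> \<le> \<delta>"
        using cases by (elim disjE conjE; hypsubst; use pos in \<open>simp add: abs_le_iff\<close>)+
      then have "slack g (x + (a\<^sub>1 * \<alpha> + a\<^sub>2 * \<beta>)) (y + (b\<^sub>1 * \<alpha> + b\<^sub>2 * \<beta>)) =
          P (a\<^sub>1 * \<alpha> + a\<^sub>2 * \<beta>) + Q (b\<^sub>1 * \<alpha> + b\<^sub>2 * \<beta>) - R ((a\<^sub>1 * \<alpha> + a\<^sub>2 * \<beta>) + (b\<^sub>1 * \<alpha> + b\<^sub>2 * \<beta>))"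
        by (rule loc)
      \<comment> \<open>Within a cone the arguments of \<open>P\<close>, \<open>Q\<close> and
        \<open>R\<close> do not change sign, so all three are linear there and the slopes are read
        off at the generators.\<close>
      also have "\<dots> = (P a\<^sub>1 + Q b\<^sub>1 - R (a\<^sub>1 + b\<^sub>1)) * \<alpha> + (P a\<^sub>2 + Q b\<^sub>2 - R (a\<^sub>2 + b\<^sub>2)) * \<beta>"
        using cases
        by (elim disjE conjE; hypsubst; use pos in \<open>simp add: P P' Q Q' R R' algebra_simps\<close>)
      finally show "slack g (x + (a\<^sub>1 * \<alpha> + a\<^sub>2 * \<beta>)) (y + (b\<^sub>1 * \<alpha> + b\<^sub>2 * \<beta>)) =
          (P a\<^sub>1 + Q b\<^sub>1 - R (a\<^sub>1 + b\<^sub>1)) * \<alpha> + (P a\<^sub>2 + Q b\<^sub>2 - R (a\<^sub>2 + b\<^sub>2)) * \<beta>" .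
    qed (use cases in \<open>elim disjE conjE; simp\<close>)+
    then show "\<exists>M. 0 \<le> M \<and> bounded_on c M" by (simp only: bounded_on_def c prod.case)
  qed
  from bchoice[OF this] obtain m where m: "\<And>c. c \<in> C \<Longrightarrow> 0 \<le> m c \<and> bounded_on c (m c)" by blast
  \<comment> \<open>The six constants are nonnegative, so their sum dominates each of them.\<close>
  define M where "M = sum m C"
  have "finite C" by (simp add: C_def)
  have main: "\<bar>slack d (x + u) (y + v)\<bar> \<le> M * slack g (x + u) (y + v)"
    if c: "(a\<^sub>1, b\<^sub>1, a\<^sub>2, b\<^sub>2) \<in> C" and "0 \<le> \<alpha>" "0 \<le> \<beta>" "\<alpha> + \<beta> \<le> \<delta>"
      "u = a\<^sub>1 * \<alpha> + a\<^sub>2 * \<beta>" "v = b\<^sub>1 * \<alpha> + b\<^sub>2 * \<beta>" for a\<^sub>1 b\<^sub>1 a\<^sub>2 b\<^sub>2 \<alpha> \<beta> u v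
  proof -
    have "m (a\<^sub>1, b\<^sub>1, a\<^sub>2, b\<^sub>2) \<le> M"
      unfolding M_def using c m \<open>finite C\<close> by (intro member_le_sum) auto
    then have "m (a\<^sub>1, b\<^sub>1, a\<^sub>2, b\<^sub>2) * slack g (x + u) (y + v) \<le> M * slack g (x + u) (y + v)"
      using nonneg by (intro mult_right_mono) auto
    moreover have "\<bar>slack d (x + u) (y + v)\<bar> \<le> m (a\<^sub>1, b\<^sub>1, a\<^sub>2, b\<^sub>2) * slack g (x + u) (y + v)"
      using m[OF c] that(2-4) unfolding that(5,6) bounded_on_def prod.case by blast
    ultimately show ?thesis by (rule order_trans[rotated])
  qed
  \<comment> \<open>Where \<open>u\<close> and \<open>v\<close> have equal signs, \<alpha> + \<beta>
    is \<bar>u\<bar> + \<bar>v\<bar>; halving \<delta> keeps this sum within \<delta>.\<close>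
  have "\<bar>slack d (x + u) (y + v)\<bar> \<le> M * slack g (x + u) (y + v)"
    if small: "\<bar>u\<bar> < \<delta> / 2" "\<bar>v\<bar> < \<delta> / 2" for u v
  proof -
    consider "0 \<le> u" "0 \<le> v" | "u \<le> 0" "v \<le> 0" | "0 \<le> u" "v \<le> 0" "u + v \<le> 0"
      | "u \<le> 0" "0 \<le> v" "0 \<le> u + v" | "u \<le> 0" "0 \<le> v" "u + v \<le> 0" | "0 \<le> u" "v \<le> 0" "0 \<le> u + v"
      by linarith
    then show ?thesis
    proof cases
      case 1 then show ?thesis
        using small by (intro main[of 1 0 0 1 u v]) (auto simp: C_def)
    next
      case 2 then show ?thesis
        using small by (intro main[of "-1" 0 0 "-1" "- u" "- v"]) (auto simp: C_def)
    next
      case 3 then show ?thesis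
        using small by (intro main[of 1 "-1" 0 "-1" u "- (u + v)"]) (auto simp: C_def)
    next
      case 4 then show ?thesis
        using small by (intro main[of "-1" 1 0 1 "- u" "u + v"]) (auto simp: C_def)
    next
      case 5 then show ?thesis
        using small by (intro main[of "-1" 1 "-1" 0 v "- (u + v)"]) (auto simp: C_def)
    next
      case 6 then show ?thesis
        using small by (intro main[of 1 "-1" 1 0 "- v" "u + v"]) (auto simp: C_def)
    qed
  qed
  then show ?thesis using \<delta> by (intro exI[of _ "\<delta> / 2"]) auto
qed

lemma slack_bound_at_pos:
  assumes contg: "continuous_on UNIV g" and contd: "continuous_on UNIV d"
    and pos: "0 < slack g x y"
  shows "\<exists>\<epsilon>>0. \<exists>M. \<forall>u v. \<bar>u\<bar> < \<epsilon> \<longrightarrow> \<bar>v\<bar> < \<epsilon> \<longrightarrow>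
     \<bar>slack d (x + u) (y + v)\<bar> \<le> M * slack g (x + u) (y + v)"
proof -
  \<comment> \<open>The summand 1 makes the inequality strict at (x, y), so by continuity it
    persists nearby.\<close>
  define M where "M = (\<bar>slack d x y\<bar> + 1) / slack g x y"
  have "continuous_on UNIV (\<lambda>w. M * slack g (x + fst w) (y + snd w) - \<bar>slack d (x + fst w) (y + snd w)\<bar>)"
    unfolding slack_def
    by (intro continuous_intros continuous_on_compose2[OF contg] continuous_on_compose2[OF contd]) auto
  then have "open ((\<lambda>w. M * slack g (x + fst w) (y + snd w) - \<bar>slack d (x + fst w) (y + snd w)\<bar>) -` {0<..})"
    (is "open ?S")
    by (intro open_vimage) auto
  moreover have "(0, 0) \<in> ?S" using pos by (simp add: M_def)
  ultimately obtain A B where AB: "open A" "open B" "(0, 0) \<in> A \<times> B" "A \<times> B \<subseteq> ?S"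
    by (rule open_prod_elim)
  have "0 \<in> A" "0 \<in> B" using AB(3) by auto
  from openE[OF AB(1) \<open>0 \<in> A\<close>] openE[OF AB(2) \<open>0 \<in> B\<close>]
  obtain \<epsilon>1 \<epsilon>2 where \<epsilon>: "0 < \<epsilon>1" "ball 0 \<epsilon>1 \<subseteq> A" "0 < \<epsilon>2" "ball 0 \<epsilon>2 \<subseteq> B"
    by metis
  have "\<bar>slack d (x + u) (y + v)\<bar> \<le> M * slack g (x + u) (y + v)"
    if "\<bar>u\<bar> < min \<epsilon>1 \<epsilon>2" "\<bar>v\<bar> < min \<epsilon>1 \<epsilon>2" for u v
  proof -
    have "u \<in> A" "v \<in> B" using that \<epsilon> by auto
    then have "(u, v) \<in> ?S" using AB by auto
    then show ?thesis by simp
  qed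
  then show ?thesis using \<epsilon> by (intro exI[of _ "min \<epsilon>1 \<epsilon>2"]) auto
qed

text \<open>Finitely many local bounds cover the compact unit square, and periodicity in both
  arguments carries the resulting bound to the whole plane.\<close>

lemma slack_bound:
  assumes cpl: "continuous_piecewise_linear g"
    and nonneg: "\<And>x y. 0 \<le> slack g x y"
    and zero: "\<And>x y. slack g x y = 0 \<Longrightarrow> slack d x y = 0"
    and K: "\<And>x y. \<bar>g x - g y\<bar> \<le> K * \<bar>x - y\<bar>"
    and L: "0 \<le> L" "\<And>x y. \<bar>d x - d y\<bar> \<le> L * \<bar>x - y\<bar>"
    and per: "\<And>x k. k \<in> \<int> \<Longrightarrow> g (x + k) = g x" "\<And>x k. k \<in> \<int> \<Longrightarrow> d (x + k) = d x"
  obtains M where "0 < M" "\<And>x y. \<bar>slack d x y\<bar> \<le> M * slack g x y"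
proof -
  have lip: "continuous_on UNIV h" if h: "\<And>x y. \<bar>h x - h y\<bar> \<le> C * \<bar>x - y\<bar>" for h :: "real \<Rightarrow> real" and C
  proof -
    \<comment> \<open>\<open>lipschitz_on\<close> asks for a nonnegative constant; the points 0 and
      1 force this.\<close>
    have "0 \<le> C" using h[of 0 1] by simp
    then have "C-lipschitz_on UNIV h" using h by (simp add: lipschitz_on_def dist_real_def)
    then show ?thesis by (rule lipschitz_on_continuous_on)
  qed
  have "\<exists>\<epsilon>>0. \<exists>M. \<forall>u v. \<bar>u\<bar> < \<epsilon> \<longrightarrow> \<bar>v\<bar> < \<epsilon> \<longrightarrow>
     \<bar>slack d (x + u) (y + v)\<bar> \<le> M * slack g (x + u) (y + v)" for x y
  proof (cases "slack g x y = 0")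
    case True
    show ?thesis by (rule slack_bound_at_zero[OF cpl nonneg zero L True])
  next
    case False
    then show ?thesis
      using nonneg[of x y] by (intro slack_bound_at_pos lip[OF K] lip[OF L(2)]) auto
  qed
  then obtain \<epsilon> m where \<epsilon>: "\<And>x y. 0 < \<epsilon> x y" and
    m: "\<And>x y u v. \<bar>u\<bar> < \<epsilon> x y \<Longrightarrow> \<bar>v\<bar> < \<epsilon> x y \<Longrightarrow>
      \<bar>slack d (x + u) (y + v)\<bar> \<le> m x y * slack g (x + u) (y + v)"
    by metis
  define U where "U p = ball (fst p) (\<epsilon> (fst p) (snd p)) \<times> ball (snd p) (\<epsilon> (fst p) (snd p))"
    for p :: "real \<times> real"
  have "compact ({0..1} \<times> {0..1} :: (real \<times> real) set)" (is "compact ?Q")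
    by (intro compact_Times compact_Icc)
  moreover have "open (U p)" for p by (simp add: U_def open_Times)
  moreover have "?Q \<subseteq> (\<Union>p\<in>UNIV. U p)"
  proof
    fix p :: "real \<times> real"
    have "p \<in> U p" using \<epsilon> by (simp add: U_def mem_Times_iff)
    then show "p \<in> (\<Union>p\<in>UNIV. U p)" by blast
  qed
  ultimately obtain F where F: "finite F" "?Q \<subseteq> (\<Union>p\<in>F. U p)"
    using compactE_image[of ?Q UNIV U] by (metis (no_types, lifting))
  \<comment> \<open>The local constants may have any sign, hence the absolute values; the summand 1
    makes \<open>M\<close> positive, so that 1 / M can serve as step size.\<close>
  define M where "M = 1 + (\<Sum>p\<in>F. \<bar>m (fst p) (snd p)\<bar>)"
  have square: "\<bar>slack d x y\<bar> \<le> M * slack g x y" if xy: "(x, y) \<in> ?Q" for x y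
  proof -
    obtain p where p: "p \<in> F" "(x, y) \<in> U p" using subsetD[OF F(2) xy] by (rule UN_E)
    have "\<bar>slack d x y\<bar> \<le> m (fst p) (snd p) * slack g x y"
      using m[of "x - fst p" "fst p" "snd p" "y - snd p"] p(2)
      by (simp add: U_def dist_real_def abs_minus_commute)
    also have "m (fst p) (snd p) \<le> M"
    proof -
      have "\<bar>m (fst p) (snd p)\<bar> \<le> (\<Sum>p\<in>F. \<bar>m (fst p) (snd p)\<bar>)"
        using F p by (intro member_le_sum[of p F "\<lambda>p. \<bar>m (fst p) (snd p)\<bar>"]) auto
      then show ?thesis by (simp add: M_def)
    qed
    then have "m (fst p) (snd p) * slack g x y \<le> M * slack g x y"
      using nonneg by (intro mult_right_mono) auto
    finally show ?thesis .
  qed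
  have slack_frac: "slack h (frac x) (frac y) = slack h x y"
    if h: "\<And>x k. k \<in> \<int> \<Longrightarrow> h (x + k) = h x" for h x y
  proof -
    have "h (frac x) = h x" for x
      using h[of "of_int \<lfloor>x\<rfloor>" "frac x"] by (simp add: frac_def)
    \<comment> \<open>The sum of the fractional parts may reach past 1, but it differs from x + y by
      an integer.\<close>
    moreover have "h (frac x + frac y) = h (x + y)"
      using h[of "of_int (\<lfloor>x\<rfloor> + \<lfloor>y\<rfloor>)" "frac x + frac y"] by (simp add: frac_def)
    ultimately show ?thesis by (simp add: slack_def)
  qed
  show thesis
  proof (rule that[of M])
    show "0 < M" unfolding M_def by (intro add_pos_nonneg sum_nonneg) auto
    fix x y
    have "(frac x, frac y) \<in> ?Q" by (simp add: less_imp_le[OF frac_lt_1])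
    from square[OF this] show "\<bar>slack d x y\<bar> \<le> M * slack g x y"
      using slack_frac[of g x y] slack_frac[of d x y] per by simp
  qed
qed

section \<open>Extreme functions and facets\<close>

lemma facet_imp_extreme:
  assumes "facet f \<pi>"
  shows "extreme_function f \<pi>"
  unfolding extreme_function_def
proof (rule conjI[OF _ allI[OF allI[OF impI[OF impI[OF impI]]]]])
  show "valid_function f \<pi>" using assms by (simp add: facet_def)
  fix \<pi>\<^sub>1 \<pi>\<^sub>2 assume val: "valid_function f \<pi>\<^sub>1" "valid_function f \<pi>\<^sub>2"
    and \<pi>: "\<pi> = (\<lambda>r. (1/2) * (\<pi>\<^sub>1 r + \<pi>\<^sub>2 r))"
  have half: "weight \<pi> y = (weight \<pi>\<^sub>1 y + weight \<pi>\<^sub>2 y) / 2" for y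
    unfolding \<pi> weight_def
    by (simp add: algebra_simps sum.distrib add_divide_distrib sum_divide_distrib)
  \<comment> \<open>Two numbers that are at least 1 and have average 1 both equal 1.\<close>
  have "weight \<pi>\<^sub>1 y = 1 \<and> weight \<pi>\<^sub>2 y = 1" if "y \<in> tight_set f \<pi>" for y
    using that val half[of y] by (auto simp: tight_set_def valid_function_def) (smt (verit))+
  then have "tight_set f \<pi> \<subseteq> tight_set f \<pi>\<^sub>1" "tight_set f \<pi> \<subseteq> tight_set f \<pi>\<^sub>2"
    by (auto simp: tight_set_def)
  then have "\<pi>\<^sub>1 = \<pi>" "\<pi>\<^sub>2 = \<pi>" using assms val by (auto simp: facet_def)
  then show "\<pi> = \<pi>\<^sub>1 \<and> \<pi> = \<pi>\<^sub>2" by simp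
qed

text \<open>By linearity of the slack, the hypothesis on \<open>c\<close> expresses subadditivity of
  the perturbed function. Its value at \<open>f\<close> stays 1 because \<pi> and \<pi>' agree
  there, and it is at least -\<bar>c\<bar> because both take values in [0, 1]. The sign of
  \<open>c\<close> is left open so that both directions are covered.\<close>

lemma perturbation_valid:
  assumes gj: "gomory_johnson f \<pi>" "gomory_johnson f \<pi>'"
    and c: "\<And>x y. c * slack (\<lambda>x. \<pi>' x - \<pi> x) x y \<le> slack \<pi> x y"
  shows "valid_function f (\<lambda>x. \<pi> x - c * (\<pi>' x - \<pi> x))"
proof (rule subadditive_imp_valid[of _ "- \<bar>c\<bar>"])
  fix x y
  show "\<pi> (x + y) - c * (\<pi>' (x + y) - \<pi> (x + y)) \<le>
      \<pi> x - c * (\<pi>' x - \<pi> x) + (\<pi> y - c * (\<pi>' y - \<pi> y))"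
    using c[of x y] by (simp add: slack_def algebra_simps)
next
  fix x
  have "\<bar>\<pi>' x - \<pi> x\<bar> \<le> 1"
    using gomory_johnsonD(1,2)[OF gj(1), of x] gomory_johnsonD(1,2)[OF gj(2), of x] by linarith
  then have "\<bar>c * (\<pi>' x - \<pi> x)\<bar> \<le> \<bar>c\<bar>" by (simp add: abs_mult mult_left_le)
  then show "- \<bar>c\<bar> \<le> \<pi> x - c * (\<pi>' x - \<pi> x)"
    using gomory_johnsonD(1)[OF gj(1), of x] by linarith
qed (simp_all add: gomory_johnsonD(3,5,7)[OF gj(1)] gomory_johnsonD(3,5,7)[OF gj(2)])

lemma extreme_imp_facet:
  assumes ext: "extreme_function f \<pi>" and cpl: "continuous_piecewise_linear \<pi>"
  shows "facet f \<pi>"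
  unfolding facet_def
proof (intro conjI allI impI)
  show "valid_function f \<pi>" using ext by (simp add: extreme_function_def)
  fix \<pi>' assume val: "valid_function f \<pi>'" and sub: "tight_set f \<pi> \<subseteq> tight_set f \<pi>'"
  have gj: "gomory_johnson f \<pi>" by (rule extreme_imp_gomory_johnson[OF ext])
  have gj': "gomory_johnson f \<pi>'" by (rule tight_gomory_johnson[OF gj sub val])
  obtain K where K: "0 \<le> K" "\<And>x y. \<bar>\<pi> x - \<pi> y\<bar> \<le> K * \<bar>x - y\<bar>"
    using tight_lipschitz[OF gj order_refl gj cpl] by blast
  obtain K' where K': "0 \<le> K'" "\<And>x y. \<bar>\<pi>' x - \<pi>' y\<bar> \<le> K' * \<bar>x - y\<bar>"
    using tight_lipschitz[OF gj sub gj' cpl] by blast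
  define d where "d = (\<lambda>x. \<pi>' x - \<pi> x)"
  obtain M where M: "0 < M" "\<And>x y. \<bar>slack d x y\<bar> \<le> M * slack \<pi> x y"
  proof (rule slack_bound[OF cpl, of d K "K + K'"])
    show "0 \<le> slack \<pi> x y" for x y
      using gomory_johnsonD(4)[OF gj, of x y] by (simp add: slack_def)
    show "slack d x y = 0" if "slack \<pi> x y = 0" for x y
      using that tight_additive[OF gj sub, of x y] by (simp add: slack_def d_def)
    show "\<bar>d x - d y\<bar> \<le> (K + K') * \<bar>x - y\<bar>" for x y
      using K(2)[of x y] K'(2)[of x y] by (simp add: d_def algebra_simps)
    show "k \<in> \<int> \<Longrightarrow> \<pi> (x + k) = \<pi> x" "k \<in> \<int> \<Longrightarrow> d (x + k) = d x" for x k
      by (simp_all add: d_def gomory_johnsonD(5)[OF gj] gomory_johnsonD(5)[OF gj'])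
  qed (use K K' in simp_all)
  \<comment> \<open>With step size 1 / M the perturbation changes the slack by at most the slack of
    \<pi>, in either direction.\<close>
  have bound: "c * slack d x y \<le> slack \<pi> x y" if "\<bar>c\<bar> = 1 / M" for c x y
  proof -
    have "c * slack d x y \<le> 1 / M * \<bar>slack d x y\<bar>"
      using that by (metis abs_ge_self abs_mult)
    also have "\<dots> \<le> slack \<pi> x y" using M by (simp add: field_simps)
    finally show ?thesis .
  qed
  have valid: "valid_function f (\<lambda>x. \<pi> x - c * d x)" if "\<bar>c\<bar> = 1 / M" for c
    using perturbation_valid[OF gj gj', of c] bound[OF that] by (simp add: d_def)
  \<comment> \<open>\<pi> is the midpoint of its perturbations by opposite steps, both valid, so
    extremality makes the step \<open>(1 / M) * d\<close> vanish.\<close>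
  have "\<pi> = (\<lambda>r. (1/2) * ((\<pi> r - (1 / M) * d r) + (\<pi> r - (- (1 / M)) * d r)))"
    by auto
  then have "\<pi> = (\<lambda>x. \<pi> x - (1 / M) * d x)"
    using ext valid[of "1 / M"] valid[of "- (1 / M)"] M(1)
    unfolding extreme_function_def by (metis abs_minus_cancel abs_of_pos zero_less_divide_1_iff)
  then have "\<pi> x = \<pi> x - (1 / M) * d x" for x by (rule fun_cong)
  then show "\<pi>' = \<pi>" using M(1) by (auto simp: d_def)
qed

theorem theorem1p2:
  fixes f :: real and \<pi> :: "real \<Rightarrow> real"
  assumes "f \<notin> \<int>"
    and "valid_function f \<pi>"
    and "continuous_piecewise_linear \<pi>"
  shows "extreme_function f \<pi> \<longleftrightarrow> facet f \<pi>"
  using extreme_imp_facet[OF _ assms(3)] facet_imp_extreme by blast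

end
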